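(* Let $n\ge 2$ and let $T$ be a tree on $n$ vertices. Then $d_t(T,i)\le\binom{n-1}{i-1}$ for every $1\le i\le n$. Moreover, $d_t(T,i)=\binom{n-1}{i-1}$ holds for all $2\le i\le n$ if and only if $T$ is the star $S_n=K_{1,n-1}$.
   Context: A set $D\subseteq V(G)$ of a finite simple graph $G$ is a total dominating set if every vertex of $G$ is adjacent to some vertex of $D$. $d_t(G,i)$ denotes the number of total dominating sets of $G$ of size $i$. *)

theory Defs
  imports "Graph_Theory.Graph_Theory"
begin

text \<open>
  Finite simple graphs are the symmetric digraphs of the locale \<^locale>\<open>graph\<close>.
  There every edge is a pair of opposite arcs, and running through both of them is a
  \<^const>\<open>pre_digraph.cycle\<close> of length 2. The library's \<^const>\<open>forest\<close> and \<^const>\<open>tree\<close>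
  forbid such cycles, so no symmetric digraph with an edge satisfies them. An undirected
  cycle is a cycle of length at least 3.
\<close>

definition undirected_tree :: "('a, 'b) pre_digraph \<Rightarrow> bool" where
  "undirected_tree T \<longleftrightarrow> graph T \<and> Digraph_Component.connected T \<and>
    \<not> (\<exists>p. pre_digraph.cycle T p \<and> 3 \<le> length p)"

text \<open>
  The arrow below is adjacency in \<open>G\<close>: the library's \<^const>\<open>arcs_ends\<close> relation.
\<close>

definition total_dominating_set :: "('a, 'b) pre_digraph \<Rightarrow> 'a set \<Rightarrow> bool" where
  "total_dominating_set G D \<longleftrightarrow> D \<subseteq> verts G \<and> (\<forall>v \<in> verts G. \<exists>u \<in> D. v \<rightarrow>\<^bsub>G\<^esub> u)"

definition num_total_dominating_sets :: "('a, 'b) pre_digraph \<Rightarrow> nat \<Rightarrow> nat" (\<open>d\<^sub>t\<close>) where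
  "d\<^sub>t G i = card {D. total_dominating_set G D \<and> card D = i}"

end

theory Submission
  imports Defs
begin

text \<open>
  A vertex \<open>c\<close> adjacent to a leaf belongs to every total dominating set, so there are at most as
  many total dominating sets of size \<open>i\<close> as there are \<open>i\<close>-subsets of the vertices containing \<open>c\<close>.
  Equality for \<open>i = 2\<close> makes every pair \<open>{c, w}\<close> totally dominating; as \<open>c\<close> itself is then
  dominated by \<open>w\<close>, the vertex \<open>c\<close> is adjacent to all others, and the absence of triangles leaves
  no further edges.
\<close>

text \<open>Deleting \<open>c\<close> matches these sets with the subsets of \<open>V - {c}\<close>
  of size \<open>i - 1\<close>. For \<open>i = 0\<close> the truncated subtraction would give 1
  although no such set exists.\<close>

lemma card_subsets_containing:
  assumes "finite V" "c \<in> V" "1 \<le> i"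
  shows "card {D. D \<subseteq> V \<and> c \<in> D \<and> card D = i} = (card V - 1) choose (i - 1)"
proof -
  let ?S = "{B. B \<subseteq> V - {c} \<and> card B = i - 1}"
  have "{D. D \<subseteq> V \<and> c \<in> D \<and> card D = i} = insert c ` ?S"
  proof (intro set_eqI iffI)
    fix D assume "D \<in> {D. D \<subseteq> V \<and> c \<in> D \<and> card D = i}"
    then have "D - {c} \<in> ?S" "D = insert c (D - {c})" by auto
    then show "D \<in> insert c ` ?S" by blast
  next
    fix D assume "D \<in> insert c ` ?S"
    then obtain B where B: "B \<subseteq> V - {c}" "card B = i - 1" "D = insert c B" by auto
    moreover from this have "finite B" "c \<notin> B" using assms(1) finite_subset by blast+
    ultimately show "D \<in> {D. D \<subseteq> V \<and> c \<in> D \<and> card D = i}" using assms by auto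
  qed
  moreover have "inj_on (insert c) ?S" by (rule inj_onI) blast
  ultimately have "card {D. D \<subseteq> V \<and> c \<in> D \<and> card D = i} = card ?S" by (simp add: card_image)
  also have "\<dots> = card (V - {c}) choose (i - 1)" using assms by (simp add: n_subsets)
  finally show ?thesis using assms by simp
qed

context graph
begin

text \<open>The first vertex of a longest path is a leaf: a second neighbour would close a cycle
  with part of the path if it lay on it, and would prolong the path otherwise.\<close>

lemma exists_leaf:
  assumes acyclic: "\<nexists>p. cycle p \<and> 3 \<le> length p" and "arcs G \<noteq> {}"
  obtains l c where "l \<rightarrow>\<^bsub>G\<^esub> c" "\<And>w. l \<rightarrow>\<^bsub>G\<^esub> w \<Longrightarrow> w = c"
proof -
  let ?P = "\<lambda>k. \<exists>u p v. apath u p v \<and> length p = k"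
  obtain a where a: "a \<in> arcs G" using assms(2) by blast
  then have "apath (tail G a) [a] (head G a)" by (auto simp: apath_simps dest: no_loops)
  then have "?P 1" by force
  \<comment> \<open>A path repeats no vertex, so its length is bounded by the number of vertices and
    the greatest length is attained.\<close>
  moreover have bounded: "\<And>k. ?P k \<Longrightarrow> k \<le> card (verts G)"
    using length_apath by blast
  ultimately have "?P (Greatest ?P)" by (rule GreatestI_nat)
  then obtain u p v where path: "apath u p v" and "length p = Greatest ?P" by blast
  then have max: "length p' \<le> length p" if "apath u' p' v'" for u' p' v'
    using that bounded Greatest_le_nat[of ?P "length p'" "card (verts G)"] by force
  \<comment> \<open>The path \<open>[a]\<close> forces the longest path to be nonempty. Its start
    \<open>u\<close> will be the leaf and \<open>head G e\<close> the only neighbour of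
    \<open>u\<close>.\<close>
  from max[OF \<open>apath (tail G a) [a] (head G a)\<close>] obtain e es where p: "p = e # es"
    by (cases p) auto
  have "e \<in> arcs G" "tail G e = u" using path by (auto simp: p apath_Cons_iff)
  then have "u \<rightarrow>\<^bsub>G\<^esub> head G e" by (auto dest: in_arcs_imp_in_arcs_ends)
  moreover have "w = head G e" if "u \<rightarrow>\<^bsub>G\<^esub> w" for w
  proof (rule ccontr)
    assume "w \<noteq> head G e"
    have "w \<noteq> u" using that adj_not_same by blast
    have "w \<rightarrow>\<^bsub>G\<^esub> u" by (rule arcs_ends_symmetric[OF sym_arcs that])
    then obtain f where f: "f \<in> arcs G" "tail G f = w" "head G f = u" by blast
    show False
    proof (cases "w \<in> set (awalk_verts u p)")
      case True
      then obtain q r where q: "p = q @ r" "awalk u q w"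
        using awalk_decomp awalkI_apath[OF path] by blast
      have "apath u q (awlast u q)" using path q(1) by (simp add: apath_append_iff)
      then have "distinct (awalk_verts u q)" by (simp add: apath_def)
      moreover have "awalk w (f # q) w" using f q by (simp add: awalk_Cons_iff)
      \<comment> \<open>From \<open>w\<close>, the walk \<open>f # q\<close> visits \<open>w\<close>
        and then \<open>awalk_verts u q\<close>; \<open>cycle\<close> asks for distinctness of the
        latter part only, which the prefix \<open>q\<close> of the path provides.\<close>
      ultimately have "cycle (f # q)"
        unfolding cycle_def using f(3) by (intro exI[of _ w] conjI) simp_all
      \<comment> \<open>An empty \<open>q\<close> would give \<open>w = u\<close>, and a single arc
        would be \<open>e\<close>, giving \<open>w = head G e\<close>.\<close>
      moreover have "2 \<le> length q"
      proof (rule ccontr)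
        assume "\<not> 2 \<le> length q"
        then consider "q = []" | g where "q = [g]"
          by (cases q; cases "tl q") auto
        then show False
          using q p \<open>w \<noteq> u\<close> \<open>w \<noteq> head G e\<close> by cases (auto simp: awalk_simps)
      qed
      ultimately show False using acyclic by force
    next
      case False
      then have "apath w (f # p) v" using f path by (simp add: apath_Cons_iff)
      then show False using max by fastforce
    qed
  qed
  ultimately show ?thesis using that by blast
qed

lemma no_triangle:
  assumes acyclic: "\<nexists>p. cycle p \<and> 3 \<le> length p"
    and "a \<rightarrow>\<^bsub>G\<^esub> b" "b \<rightarrow>\<^bsub>G\<^esub> c" "c \<rightarrow>\<^bsub>G\<^esub> a"
  shows False
proof -
  obtain e f g where arcs: "e \<in> arcs G" "tail G e = a" "head G e = b"
    "f \<in> arcs G" "tail G f = b" "head G f = c" "g \<in> arcs G" "tail G g = c" "head G g = a"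
    using assms(2-4) by (metis reachableE)
  have "a \<noteq> b" "b \<noteq> c" "c \<noteq> a" using assms(2-4) adj_not_same by blast+
  with arcs have "cycle [e, f, g]"
    unfolding cycle_def by (auto simp: awalk_simps intro!: exI[of _ a])
  then show False using acyclic by fastforce
qed

text \<open>Some member of \<open>D\<close> must be adjacent to the leaf \<open>l\<close>, and
  \<open>c\<close> is the only candidate.\<close>

lemma support_vertex_in_total_dominating_set:
  assumes "total_dominating_set G D" "l \<rightarrow>\<^bsub>G\<^esub> c" "\<And>w. l \<rightarrow>\<^bsub>G\<^esub> w \<Longrightarrow> w = c"
  shows "c \<in> D"
proof -
  obtain u where "u \<in> D" "l \<rightarrow>\<^bsub>G\<^esub> u"
    using assms(1) adj_in_verts(1)[OF assms(2)] unfolding total_dominating_set_def by blast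
  then show ?thesis using assms(3) by simp
qed

end

lemma connected_imp_arcs_nonempty:
  assumes "graph G" "Digraph_Component.connected G" "2 \<le> card (verts G)"
  shows "arcs G \<noteq> {}"
proof -
  interpret graph G by fact
  obtain u v where "u \<in> verts G" "v \<in> verts G" "u \<noteq> v"
    using card_le_Suc0_iff_eq[OF finite_verts] assms(3) by fastforce
  \<comment> \<open>As the two vertices differ, the walk joining them is nonempty and so has a first
    arc.\<close>
  then have "u \<rightarrow>\<^sup>+\<^bsub>G\<^esub> v"
    using symmetric_connected_imp_strongly_connected[OF sym_arcs assms(2)]
    by (auto simp: strongly_connected_def)
  then show ?thesis by (auto simp: arcs_ends_def dest: tranclD)
qed

text \<open>Each leaf can be dominated only by the centre \<open>c\<close>, which dominates all
  leaves at once. The centre itself needs a leaf in \<open>D\<close>, and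
  \<open>2 \<le> card D\<close> supplies one by excluding \<open>{c}\<close>.\<close>

lemma total_dominating_sets_star:
  assumes "graph G" "verts G = insert c V" "c \<notin> V" "V \<noteq> {}"
    and star: "arcs_ends G = {c} \<times> V \<union> V \<times> {c}" and "2 \<le> card D"
  shows "total_dominating_set G D \<longleftrightarrow> D \<subseteq> verts G \<and> c \<in> D"
proof
  assume D: "total_dominating_set G D"
  obtain l where "l \<in> V" using assms(4) by blast
  then show "D \<subseteq> verts G \<and> c \<in> D"
    using D star assms(2,3) unfolding total_dominating_set_def by auto
next
  assume D: "D \<subseteq> verts G \<and> c \<in> D"
  have "D \<noteq> {c}" using assms(6) by auto
  then obtain w where "w \<in> D" "w \<in> V" using D assms(2) by blast
  then show "total_dominating_set G D"
    using D star assms(2) unfolding total_dominating_set_def by auto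
qed

theorem theorem5:
  fixes T :: "('a, 'b) pre_digraph" and n :: nat
  assumes "n \<ge> 2"
    and "undirected_tree T"
    and "card (verts T) = n"
  shows "(\<forall>i \<in> {1..n}. d\<^sub>t T i \<le> (n - 1) choose (i - 1)) \<and>
    ((\<forall>i \<in> {2..n}. d\<^sub>t T i = (n - 1) choose (i - 1)) \<longleftrightarrow> K\<^bsub>1,n - 1\<^esub> T)"
proof -
  have "graph T" and conn: "Digraph_Component.connected T"
    and acyclic: "\<nexists>p. pre_digraph.cycle T p \<and> 3 \<le> length p"
    using assms(2) by (auto simp: undirected_tree_def)
  interpret graph T by fact
  let ?V = "verts T"
  obtain l c where leaf: "l \<rightarrow>\<^bsub>T\<^esub> c" "\<And>w. l \<rightarrow>\<^bsub>T\<^esub> w \<Longrightarrow> w = c"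
    using exists_leaf acyclic connected_imp_arcs_nonempty[OF \<open>graph T\<close> conn] assms by blast
  have cV: "c \<in> ?V" using leaf(1) adj_in_verts by blast
  let ?C = "\<lambda>i. {D. D \<subseteq> ?V \<and> c \<in> D \<and> card D = i}"
  have sub: "{D. total_dominating_set T D \<and> card D = i} \<subseteq> ?C i" for i
    using support_vertex_in_total_dominating_set[OF _ leaf]
    by (auto simp: total_dominating_set_def)
  have finC: "finite (?C i)" for i
    by (rule finite_subset[of _ "Pow ?V"]) auto
  have cardC: "card (?C i) = (n - 1) choose (i - 1)" if "1 \<le> i" for i
    using card_subsets_containing[OF _ cV that] assms(3) by simp
  have bound: "d\<^sub>t T i \<le> (n - 1) choose (i - 1)" if "1 \<le> i" for i
    using card_mono[OF finC sub, of i] cardC[OF that] by (simp add: num_total_dominating_sets_def)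

  have star: "K\<^bsub>1,n - 1\<^esub> T" if eq: "\<forall>i \<in> {2..n}. d\<^sub>t T i = (n - 1) choose (i - 1)"
  proof -
    have "card {D. total_dominating_set T D \<and> card D = 2} = card (?C 2)"
      using eq assms(1) cardC[of 2] by (simp add: num_total_dominating_sets_def)
    \<comment> \<open>A subset of the finite set \<open>?C 2\<close> with the same cardinality is
      all of it.\<close>
    then have all: "{D. total_dominating_set T D \<and> card D = 2} = ?C 2"
      using card_subset_eq[OF finC sub] by blast
    have adj: "c \<rightarrow>\<^bsub>T\<^esub> w" if "w \<in> ?V" "w \<noteq> c" for w
    proof -
      have "{c, w} \<in> ?C 2" using that cV by auto
      then have "total_dominating_set T {c, w}" using all by blast
      then obtain x where "x \<in> {c, w}" "c \<rightarrow>\<^bsub>T\<^esub> x"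
        using cV unfolding total_dominating_set_def by blast
      then show ?thesis using adj_not_same by blast
    qed
    have adj': "w \<rightarrow>\<^bsub>T\<^esub> c" if "w \<in> ?V" "w \<noteq> c" for w
      using adj[OF that] arcs_ends_symmetric[OF sym_arcs] by blast
    have "arcs_ends T \<subseteq> {c} \<times> (?V - {c}) \<union> (?V - {c}) \<times> {c}"
    proof (rule subrelI)
      fix a b assume ab: "a \<rightarrow>\<^bsub>T\<^esub> b"
      have "a \<in> ?V" "b \<in> ?V" "a \<noteq> b" using ab adj_in_verts adj_not_same by blast+
      \<comment> \<open>An edge avoiding \<open>c\<close> would form a triangle with
        \<open>c\<close>, since both of its ends are adjacent to \<open>c\<close>.\<close>
      moreover have "a = c \<or> b = c"
        using no_triangle[OF acyclic ab adj' adj] calculation by blast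
      ultimately show "(a, b) \<in> {c} \<times> (?V - {c}) \<union> (?V - {c}) \<times> {c}" by auto
    qed
    moreover have "{c} \<times> (?V - {c}) \<union> (?V - {c}) \<times> {c} \<subseteq> arcs_ends T"
      by (auto intro: adj adj')
    ultimately have "arcs_ends T = {c} \<times> (?V - {c}) \<union> (?V - {c}) \<times> {c}"
      by (rule equalityI)
    moreover have "?V = {c} \<union> (?V - {c})" "card (?V - {c}) = n - 1" using cV assms(3) by auto
    moreover have "{c} \<inter> (?V - {c}) = {}" "card {c} = 1" by auto
    ultimately show ?thesis
      unfolding complete_bipartite_digraph_def using \<open>graph T\<close> by blast
  qed

  \<comment> \<open>The range starts at 2 because a single vertex never dominates itself: the count
    for \<open>i = 1\<close> is 0, while the binomial coefficient is 1.\<close>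
  have eq: "d\<^sub>t T i = (n - 1) choose (i - 1)" if K: "K\<^bsub>1,n - 1\<^esub> T" and i: "2 \<le> i" for i
  proof -
    obtain U V where UV: "?V = U \<union> V" "U \<inter> V = {}" "card U = 1" "card V = n - 1"
      "arcs_ends T = U \<times> V \<union> V \<times> U"
      using K unfolding complete_bipartite_digraph_def by blast
    \<comment> \<open>The centre \<open>z\<close> is read off from the bipartition. It may differ
      from \<open>c\<close> when \<open>n = 2\<close>, so the subsets are counted anew with
      \<open>z\<close>.\<close>
    obtain z where z: "U = {z}" using UV(3) card_1_singletonE by blast
    have "V \<noteq> {}" using UV(4) assms(1) by auto
    then have "{D. total_dominating_set T D \<and> card D = i} = {D. D \<subseteq> ?V \<and> z \<in> D \<and> card D = i}"
      using total_dominating_sets_star[OF \<open>graph T\<close>, of z V] UV z i by auto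
    then show ?thesis
      using card_subsets_containing[OF finite_verts, of z i] UV(1) z i assms(3)
      by (simp add: num_total_dominating_sets_def)
  qed

  show ?thesis using bound star eq by auto
qed

end
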